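(* Let $k \ge 3$ be an integer and let $G^I(k) = (C \cup (V\setminus C), E)$ be any graph with vertex set $V$ and $C\subseteq V$ such that $|C|=k$, the induced subgraph $G^I(k)[C]$ has no closed twins, and $V\setminus C$ consists of exactly one vertex $v_{C'}$ with $N(v_{C'})\cap C=C'$ for each non-empty subset $C'\subseteq C$ such that there is no vertex $u\in C$ with $N[u]\cap C=C'$ (with no condition on the edges inside $V\setminus C$). Then in $G^I(k)$, the set $C$ is a minimum-cardinality (i) ID-code; (ii) ITD-code if $G^I(k)[C]$ has no isolated vertex, that is, if $G^I(k)[C]$ is ITD-admissible. Moreover, for $X \in \{\mathrm{ID}, \mathrm{ITD}\}$, the minimum X-density among all X-admissible graphs with X-number $k$ is attained by any graph $G^I(k)$ if $X=\mathrm{ID}$, and by those graphs $G^I(k)$ for which $G^I(k)[C]$ has no isolated vertex if $X=\mathrm{ITD}$.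
   Context: Graphs are finite, simple and undirected. For a graph $G=(V,E)$ and $v\in V$, $N(v)$ is the open neighborhood and $N[v]=N(v)\cup\{v\}$ the closed neighborhood; $G[C]$ is the subgraph induced by $C$. Closed twins are distinct adjacent vertices $u,v$ with $N[u]=N[v]$. A set $C\subseteq V$ is dominating (resp. total-dominating) if $N[v]\cap C\neq\emptyset$ (resp. $N(v)\cap C\ne\emptyset$) for all $v\in V$. A set $C$ is closed-separating if $N[u]\cap C\neq N[v]\cap C$ for all distinct $u,v\in V$. An ID-code (resp. ITD-code) is a set that is closed-separating and dominating (resp. total-dominating). A graph is X-admissible if it has an X-code; the X-number $\gamma^{X}(G)$ of an X-admissible graph is the minimum cardinality of an X-code of $G$. The X-density of an X-admissible graph $G$ on $n$ vertices is $\gamma^{X}(G)/n$. *)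

theory Defs
  imports Complex_Main "Graph_Theory.Digraph_Component"
begin

text \<open>
  Finite simple undirected graphs are digraphs satisfying the library locale predicate
  \<open>graph\<close>: finite, loop-free, without parallel arcs, and with a symmetric adjacency relation.
\<close>

definition nbhd :: "('a, 'b) pre_digraph \<Rightarrow> 'a \<Rightarrow> 'a set" where
  "nbhd G v = {u. v \<rightarrow>\<^bsub>G\<^esub> u}"

definition closed_nbhd :: "('a, 'b) pre_digraph \<Rightarrow> 'a \<Rightarrow> 'a set" where
  "closed_nbhd G v = insert v (nbhd G v)"

definition closed_twins :: "('a, 'b) pre_digraph \<Rightarrow> 'a \<Rightarrow> 'a \<Rightarrow> bool" where
  "closed_twins G u v \<longleftrightarrow> u \<in> verts G \<and> v \<in> verts G \<and> u \<noteq> v \<and> u \<rightarrow>\<^bsub>G\<^esub> v \<and>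
     closed_nbhd G u = closed_nbhd G v"

definition isolated :: "('a, 'b) pre_digraph \<Rightarrow> 'a \<Rightarrow> bool" where
  "isolated G v \<longleftrightarrow> v \<in> verts G \<and> nbhd G v = {}"

definition dominating :: "('a, 'b) pre_digraph \<Rightarrow> 'a set \<Rightarrow> bool" where
  "dominating G C \<longleftrightarrow> C \<subseteq> verts G \<and> (\<forall>v\<in>verts G. closed_nbhd G v \<inter> C \<noteq> {})"

definition total_dominating :: "('a, 'b) pre_digraph \<Rightarrow> 'a set \<Rightarrow> bool" where
  "total_dominating G C \<longleftrightarrow> C \<subseteq> verts G \<and> (\<forall>v\<in>verts G. nbhd G v \<inter> C \<noteq> {})"

definition closed_separating :: "('a, 'b) pre_digraph \<Rightarrow> 'a set \<Rightarrow> bool" where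
  "closed_separating G C \<longleftrightarrow> C \<subseteq> verts G \<and>
     (\<forall>u\<in>verts G. \<forall>v\<in>verts G. u \<noteq> v \<longrightarrow> closed_nbhd G u \<inter> C \<noteq> closed_nbhd G v \<inter> C)"

datatype code_kind = ID | ITD

fun is_code :: "code_kind \<Rightarrow> ('a, 'b) pre_digraph \<Rightarrow> 'a set \<Rightarrow> bool" where
  "is_code ID G C \<longleftrightarrow> closed_separating G C \<and> dominating G C"
| "is_code ITD G C \<longleftrightarrow> closed_separating G C \<and> total_dominating G C"

definition admissible :: "code_kind \<Rightarrow> ('a, 'b) pre_digraph \<Rightarrow> bool" where
  "admissible X G \<longleftrightarrow> (\<exists>C. is_code X G C)"

text \<open>The number and the density are meaningful only for admissible graphs.\<close>

definition code_number :: "code_kind \<Rightarrow> ('a, 'b) pre_digraph \<Rightarrow> nat" where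
  "code_number X G = (LEAST m. \<exists>C. is_code X G C \<and> card C = m)"

definition code_density :: "code_kind \<Rightarrow> ('a, 'b) pre_digraph \<Rightarrow> real" where
  "code_density X G = real (code_number X G) / real (card (verts G))"

abbreviation min_code :: "code_kind \<Rightarrow> ('a, 'b) pre_digraph \<Rightarrow> 'a set \<Rightarrow> bool" where
  "min_code X G C \<equiv> is_arg_min card (is_code X G) C"

text \<open>
  \<open>GI_graph k G C\<close> says that \<open>G\<close> is a graph \<open>G\<^sup>I(k)\<close> with distinguished set \<open>C\<close>.
  The bijection expresses that each non-empty subset of \<open>C\<close> that is not the trace on \<open>C\<close> of the
  closed neighbourhood of a vertex of \<open>C\<close> is the trace of the neighbourhood of exactly one vertex
  outside \<open>C\<close>, and that there are no further vertices.
\<close>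

definition GI_graph :: "nat \<Rightarrow> ('a, 'b) pre_digraph \<Rightarrow> 'a set \<Rightarrow> bool" where
  "GI_graph k G C \<longleftrightarrow> graph G \<and> C \<subseteq> verts G \<and> card C = k \<and>
     (\<nexists>u v. closed_twins (G \<restriction> C) u v) \<and>
     bij_betw (\<lambda>v. nbhd G v \<inter> C) (verts G - C)
       {C'. C' \<noteq> {} \<and> C' \<subseteq> C \<and> (\<nexists>u. u \<in> C \<and> closed_nbhd G u \<inter> C = C')}"

end

theory Submission
  imports Defs
begin

text \<open>
  A set \<open>C\<close> is closed-separating and dominating iff \<open>v \<mapsto> N[v] \<inter> C\<close> maps the vertices
  injectively into the non-empty subsets of \<open>C\<close>; hence a graph with such a set has at most
  \<open>2 ^ card C - 1\<close> vertices. In a graph \<open>G\<^sup>I(k)\<close> this map is a bijection for the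
  distinguished set, so the bound is attained, which gives both the minimality of \<open>C\<close> and
  that of the density.
\<close>

section \<open>Traces in induced subgraphs, and what both kinds of codes share\<close>

lemma nbhd_induce: "v \<in> C \<Longrightarrow> nbhd (G \<restriction> C) v = nbhd G v \<inter> C"
  by (auto simp: nbhd_def arcs_ends_def arc_to_ends_def image_iff)

lemma closed_nbhd_induce: "v \<in> C \<Longrightarrow> closed_nbhd (G \<restriction> C) v = closed_nbhd G v \<inter> C"
  by (auto simp: closed_nbhd_def nbhd_induce)

lemma is_code_imp_closed_separating: "is_code X G C \<Longrightarrow> closed_separating G C"
  by (cases X) auto

text \<open>Total domination is the stronger property because \<open>nbhd\<close> lies inside
  \<open>closed_nbhd\<close>. This lets the order bound treat both kinds of codes at once.\<close>

lemma is_code_imp_dominating: "is_code X G C \<Longrightarrow> dominating G C"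
  by (cases X) (auto simp: dominating_def total_dominating_def closed_nbhd_def)

lemma is_code_imp_subset: "is_code X G C \<Longrightarrow> C \<subseteq> verts G"
  using is_code_imp_dominating[of X G C] by (simp add: dominating_def)

section \<open>Bounds on the order and the density in terms of the code number\<close>

lemma card_nonempty_subsets: "finite C \<Longrightarrow> card (Pow C - {{}}) = 2 ^ card C - 1"
  by (simp add: card_Diff_singleton card_Pow)

lemma card_verts_le:
  assumes "finite (verts G)" "is_code X G C"
  shows "card (verts G) \<le> 2 ^ card C - 1"
proof -
  have fin: "finite C"
    using assms is_code_imp_subset finite_subset by metis
  have "inj_on (\<lambda>v. closed_nbhd G v \<inter> C) (verts G)"
    using is_code_imp_closed_separating[OF assms(2)]
    by (auto simp: inj_on_def closed_separating_def)
  moreover have "(\<lambda>v. closed_nbhd G v \<inter> C) ` verts G \<subseteq> Pow C - {{}}"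
    using is_code_imp_dominating[OF assms(2)] by (auto simp: dominating_def)
  ultimately have "card (verts G) \<le> card (Pow C - {{}})"
    using fin by (intro card_inj_on_le) auto
  then show ?thesis
    by (simp only: card_nonempty_subsets[OF fin])
qed

lemma code_number_attained:
  assumes "admissible X G"
  obtains C where "is_code X G C" "card C = code_number X G"
proof -
  from assms obtain C where "is_code X G C"
    by (auto simp: admissible_def)
  then have "\<exists>C'. is_code X G C' \<and> card C' = code_number X G"
    unfolding code_number_def
    by (intro LeastI[where P = "\<lambda>m. \<exists>C. is_code X G C \<and> card C = m" and k = "card C"]) blast
  then show thesis
    using that by blast
qed

lemma code_number_min_code:
  assumes "min_code X G C"
  shows "code_number X G = card C"
  unfolding code_number_def using assms
  by (intro Least_equality) (auto simp: is_arg_min_linorder)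

text \<open>A minimum code of size m bounds the order by 2 ^ m - 1, and m divided by the order
  decreases as the order grows. The bound depends on m alone, so it applies to all graphs sharing a
  code number.\<close>

lemma code_density_ge:
  assumes "finite (verts G)" "admissible X G"
  shows "real (code_number X G) / real (2 ^ code_number X G - 1) \<le> code_density X G"
proof -
  obtain C where C: "is_code X G C" "card C = code_number X G"
    using assms(2) by (rule code_number_attained)
  have "card C \<le> card (verts G)"
    using is_code_imp_subset[OF C(1)] assms(1) by (rule card_mono[rotated])
  show ?thesis
  \<comment> \<open>For code number 0 both quotients have numerator 0. Otherwise the minimum code is
    non-empty, which makes both denominators positive.\<close>
  proof (cases "code_number X G = 0")
    case False
    with \<open>card C \<le> card (verts G)\<close> C(2) have "0 < card (verts G)"
      by linarith
    moreover have le: "card (verts G) \<le> 2 ^ code_number X G - 1"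
      using card_verts_le[OF assms(1) C(1)] C(2) by simp
    ultimately have "0 < (2::nat) ^ code_number X G - 1"
      by (rule less_le_trans)
    with \<open>0 < card (verts G)\<close> show ?thesis
      unfolding code_density_def
      by (intro divide_left_mono mult_pos_pos of_nat_0_le_iff
          of_nat_mono[OF le] of_nat_0_less_iff[THEN iffD2])
  qed (simp add: code_density_def)
qed

lemma isolated_imp_not_ITD_admissible:
  assumes "isolated G v"
  shows "\<not> admissible ITD G"
  using assms by (auto simp: admissible_def isolated_def total_dominating_def)

section \<open>Properties of the graphs described by \<open>GI_graph\<close>\<close>

context
  fixes k :: nat and G :: "('a, 'b) pre_digraph" and C :: "'a set"
  assumes GI: "GI_graph k G C"
begin

lemma GI_finite_verts: "finite (verts G)"
proof -
  interpret graph G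
    using GI by (simp add: GI_graph_def)
  show ?thesis
    by simp
qed

lemma GI_subset: "C \<subseteq> verts G"
  and GI_card: "card C = k"
  and GI_no_closed_twins: "\<not> closed_twins (G \<restriction> C) u v"
  and GI_outer: "bij_betw (\<lambda>v. nbhd G v \<inter> C) (verts G - C)
       {C'. C' \<noteq> {} \<and> C' \<subseteq> C \<and> (\<nexists>u. u \<in> C \<and> closed_nbhd G u \<inter> C = C')}"
  using GI by (auto simp: GI_graph_def)

lemma GI_finite: "finite C"
  using GI_subset GI_finite_verts by (rule finite_subset)

text \<open>Two vertices of \<open>C\<close> with equal traces have equal closed neighbourhoods in
  the induced subgraph. Each then lies in the closed neighbourhood of the other, so they are
  adjacent and hence closed twins.\<close>

lemma GI_inj_inner: "inj_on (\<lambda>v. closed_nbhd G v \<inter> C) C"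
proof (rule inj_onI, rule ccontr)
  fix u v
  assume uv: "u \<in> C" "v \<in> C" "closed_nbhd G u \<inter> C = closed_nbhd G v \<inter> C" "u \<noteq> v"
  then have eq: "closed_nbhd (G \<restriction> C) u = closed_nbhd (G \<restriction> C) v"
    by (simp add: closed_nbhd_induce)
  then have "v \<in> nbhd (G \<restriction> C) u"
    using uv(4) by (auto simp: closed_nbhd_def)
  with uv eq have "closed_twins (G \<restriction> C) u v"
    by (simp add: closed_twins_def nbhd_def)
  then show False
    using GI_no_closed_twins by blast
qed

lemma GI_bij_betw: "bij_betw (\<lambda>v. closed_nbhd G v \<inter> C) (verts G) (Pow C - {{}})"
proof -
  let ?f = "\<lambda>v. closed_nbhd G v \<inter> C"
  let ?B = "{C'. C' \<noteq> {} \<and> C' \<subseteq> C \<and> (\<nexists>u. u \<in> C \<and> ?f u = C')}"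
  have "bij_betw ?f C (?f ` C)"
    using GI_inj_inner by (rule inj_on_imp_bij_betw)
  moreover have "bij_betw ?f (verts G - C) ?B"
    \<comment> \<open>A vertex outside \<open>C\<close> does not occur in its own trace, so its open
      and closed neighbourhoods have the same trace.\<close>
    using GI_outer by (rule bij_betw_cong[THEN iffD1, rotated]) (auto simp: closed_nbhd_def)
  ultimately have "bij_betw ?f (C \<union> (verts G - C)) (?f ` C \<union> ?B)"
    by (rule bij_betw_combine) auto
  moreover have "C \<union> (verts G - C) = verts G"
    using GI_subset by blast
  moreover have "?f ` C \<union> ?B = Pow C - {{}}"
    by (auto simp: closed_nbhd_def)
  ultimately show ?thesis
    by simp
qed

lemma GI_card_verts: "card (verts G) = 2 ^ k - 1"
  using bij_betw_same_card[OF GI_bij_betw]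
  by (simp only: card_nonempty_subsets[OF GI_finite] GI_card)

lemma GI_closed_separating: "closed_separating G C"
  using GI_bij_betw GI_subset
  by (auto simp: closed_separating_def bij_betw_def inj_on_def)

lemma GI_is_code_ID: "is_code ID G C"
proof -
  have "closed_nbhd G v \<inter> C \<noteq> {}" if "v \<in> verts G" for v
    using bij_betwE[OF GI_bij_betw] that by auto
  then show ?thesis
    using GI_closed_separating GI_subset by (simp add: dominating_def)
qed

text \<open>Vertices outside \<open>C\<close> have non-empty open traces by construction; the
  assumption on isolated vertices takes care of those in \<open>C\<close>.\<close>

lemma GI_is_code_ITD:
  assumes "\<nexists>v. isolated (G \<restriction> C) v"
  shows "is_code ITD G C"
proof -
  have "nbhd G v \<inter> C \<noteq> {}" if "v \<in> verts G" for v
  proof (cases "v \<in> C")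
    case True
    with assms show ?thesis
      by (auto simp: isolated_def nbhd_induce)
  next
    case False
    with that show ?thesis
      using bij_betwE[OF GI_outer] by blast
  qed
  then show ?thesis
    using GI_closed_separating GI_subset by (simp add: total_dominating_def)
qed

text \<open>The whole vertex set \<open>C\<close> of the induced subgraph serves as the
  code.\<close>

lemma GI_induced_ITD_admissible:
  assumes "\<nexists>v. isolated (G \<restriction> C) v"
  shows "admissible ITD (G \<restriction> C)"
proof -
  have "closed_separating (G \<restriction> C) C"
    using GI_inj_inner
    by (auto simp: closed_separating_def closed_nbhd_induce inj_on_def)
  moreover have "total_dominating (G \<restriction> C) C"
    using assms by (auto simp: total_dominating_def isolated_def nbhd_induce)
  ultimately show ?thesis
    by (auto simp: admissible_def)
qed

text \<open>The order 2 ^ k - 1 of \<open>G\<close> is the largest that a code of size k allows, so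
  a smaller code could not separate all vertices.\<close>

lemma GI_min_code:
  assumes "is_code X G C"
  shows "min_code X G C"
proof -
  have "card C \<le> card D" if "is_code X G D" for D
  proof -
    have "(2::nat) ^ k - 1 \<le> 2 ^ card D - 1"
      using card_verts_le[OF GI_finite_verts that] by (simp add: GI_card_verts)
    \<comment> \<open>Both powers are at least 1, so the truncated subtraction cancels.\<close>
    then have "(2::nat) ^ k \<le> 2 ^ card D"
      by (simp add: le_diff_iff)
    then show ?thesis
      by (simp add: GI_card)
  qed
  with assms show ?thesis
    by (simp add: is_arg_min_linorder)
qed

lemma GI_code_number: "is_code X G C \<Longrightarrow> code_number X G = k"
  using code_number_min_code[OF GI_min_code] by (simp only: GI_card)

text \<open>The density of \<open>G\<close> is exactly k / (2 ^ k - 1), the lower bound of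
  \<open>code_density_ge\<close>.\<close>

lemma GI_code_density_le:
  assumes "is_code X G C" "finite (verts H)" "admissible X H" "code_number X H = k"
  shows "code_density X G \<le> code_density X H"
  using code_density_ge[OF assms(2,3)] assms(4)
  by (simp add: code_density_def GI_code_number[OF assms(1)] GI_card_verts)

end

text \<open>
  For existence, the subgraph induced by \<open>C = {..<k}\<close> is taken to be a star with centre \<open>0\<close>,
  which has no closed twins as soon as \<open>k \<ge> 3\<close>.
\<close>

lemma GI_graph_exists:
  assumes k: "k \<ge> 3"
  shows "\<exists>(G :: (nat, nat \<times> nat) pre_digraph) C.
    GI_graph k G C \<and> (\<nexists>v. isolated (G \<restriction> C) v)"
proof -
  define C where "C = {..<k}"
  \<comment> \<open>\<open>star u\<close> is the intended closed neighbourhood of \<open>u\<close>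
    within \<open>C\<close>, and \<open>F\<close> below collects the subsets still to be realised by
    outer vertices.\<close>
  define star where "star u = (if u = 0 then C else {0, u})" for u
  define F where "F = {C'. C' \<noteq> {} \<and> C' \<subseteq> C \<and> (\<nexists>u. u \<in> C \<and> star u = C')}"
  define n where "n = k + card F"
  have "finite F"
    by (rule finite_subset[of _ "Pow C"]) (auto simp: F_def C_def)
  then obtain f where f: "bij_betw f {k..<n} F"
    using finite_same_card_bij[of "{k..<n}" F] by (auto simp: n_def)
  have f_subset: "f v \<subseteq> {..<k}" if "k \<le> v" "v < n" for v
    using bij_betwE[OF f] that by (auto simp: F_def C_def)
  \<comment> \<open>The three sets are the star edges inside \<open>C\<close> and, in both
    directions, the edges joining an outer vertex \<open>v\<close> to \<open>f v\<close>. Outer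
    vertices are pairwise non-adjacent.\<close>
  define A where "A = {(u, v). u < k \<and> v < k \<and> u \<noteq> v \<and> (u = 0 \<or> v = 0)} \<union>
    {(u, v). k \<le> v \<and> v < n \<and> u \<in> f v} \<union> {(u, v). k \<le> u \<and> u < n \<and> v \<in> f u}"
  define G :: "(nat, nat \<times> nat) pre_digraph"
    where "G = \<lparr>verts = {..<n}, arcs = A, tail = fst, head = snd\<rparr>"
  have "k \<le> n"
    by (simp add: n_def)
  have A_bounds: "u < n \<and> v < n \<and> u \<noteq> v" if "(u, v) \<in> A" for u v
    using that f_subset \<open>k \<le> n\<close> by (fastforce simp: A_def)
  have adj: "u \<rightarrow>\<^bsub>G\<^esub> v \<longleftrightarrow> (u, v) \<in> A" for u v
    by (force simp: G_def arcs_ends_def arc_to_ends_def)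
  have "sym A"
    by (auto simp: sym_def A_def)
  have "finite A"
    by (rule finite_subset[of _ "{..<n} \<times> {..<n}"]) (use A_bounds in auto)
  have "graph G"
    by unfold_locales
      (use A_bounds \<open>finite A\<close> \<open>sym A\<close> in
        \<open>auto simp: G_def arc_to_ends_def symmetric_def arcs_ends_def\<close>)
  have inner: "closed_nbhd G u \<inter> C = star u" if "u \<in> C" for u
    using that k by (auto simp: closed_nbhd_def nbhd_def adj A_def star_def C_def)
  have outer: "nbhd G v \<inter> C = f v" if "v \<in> verts G - C" for v
  proof -
    from that have "k \<le> v" "v < n"
      by (auto simp: G_def C_def)
    then show ?thesis
      using f_subset[of v] unfolding nbhd_def adj C_def A_def by auto
  qed
  have "verts G - C = {k..<n}"
    by (auto simp: G_def C_def)
  then have "bij_betw (\<lambda>v. nbhd G v \<inter> C) (verts G - C) F"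
    using f outer bij_betw_cong[of "{k..<n}" "\<lambda>v. nbhd G v \<inter> C" f F] by simp
  moreover have "F = {C'. C' \<noteq> {} \<and> C' \<subseteq> C \<and> (\<nexists>u. u \<in> C \<and> closed_nbhd G u \<inter> C = C')}"
    using inner by (auto simp: F_def)
  moreover have "star u \<noteq> star v" if "u \<in> C" "v \<in> C" "u \<noteq> v" for u v
  proof -
    \<comment> \<open>The bound \<open>k \<ge> 3\<close> distinguishes the centre from the leaves:
      for \<open>k = 2\<close> the star is a single edge, whose ends are closed twins.\<close>
    have "{0, w} \<noteq> C" for w
    proof -
      have "card {0, w} \<le> 2"
        by (simp add: card_insert_if)
      then have "card {0, w} \<noteq> card C"
        using k by (simp add: C_def)
      then show ?thesis
        by metis
    qed
    then have "{0, w} \<noteq> C" "C \<noteq> {0, w}" for w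
      by metis+
    then show ?thesis
      using that by (auto simp: star_def doubleton_eq_iff)
  qed
  then have "\<nexists>u v. closed_twins (G \<restriction> C) u v"
    by (auto simp: closed_twins_def closed_nbhd_induce inner)
  moreover have "C \<subseteq> verts G" "card C = k"
    using \<open>k \<le> n\<close> by (auto simp: C_def G_def)
  ultimately have "GI_graph k G C"
    using \<open>graph G\<close> by (simp add: GI_graph_def)
  moreover have "\<nexists>v. isolated (G \<restriction> C) v"
  proof
    assume "\<exists>v. isolated (G \<restriction> C) v"
    then obtain v where v: "v \<in> C" "nbhd G v \<inter> C = {}"
      by (auto simp: isolated_def nbhd_induce)
    \<comment> \<open>A leaf sees the centre 0, and the centre sees the leaf 1.\<close>
    moreover have "(if v = 0 then 1 else 0) \<in> nbhd G v \<inter> C"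
      using v(1) k by (auto simp: nbhd_def adj A_def C_def)
    ultimately show False
      by blast
  qed
  ultimately show ?thesis
    by blast
qed

text \<open>The last conjunct ensures that the minimum density is attained for both kinds of codes.
  \<open>H\<close> has type variables of its own, so competing graphs are not tied to the types of
  \<open>G\<close>.\<close>

theorem theorem6:
  fixes k :: nat
  assumes "k \<ge> 3"
  shows
    "(\<forall>(G :: ('a, 'b) pre_digraph) C. GI_graph k G C \<longrightarrow>
        min_code ID G C \<and>
        ((\<nexists>v. isolated (G \<restriction> C) v) \<longleftrightarrow> admissible ITD (G \<restriction> C)) \<and>
        ((\<nexists>v. isolated (G \<restriction> C) v) \<longrightarrow> min_code ITD G C) \<and>
        (\<forall>X. X = ID \<or> (X = ITD \<and> (\<nexists>v. isolated (G \<restriction> C) v)) \<longrightarrow>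
           admissible X G \<and> code_number X G = k \<and>
           (\<forall>H :: ('c, 'd) pre_digraph.
              graph H \<and> admissible X H \<and> code_number X H = k \<longrightarrow>
              code_density X G \<le> code_density X H))) \<and>
     (\<exists>(G :: (nat, nat \<times> nat) pre_digraph) C.
        GI_graph k G C \<and> (\<nexists>v. isolated (G \<restriction> C) v))"
proof (intro conjI allI impI)
  fix G :: "('a, 'b) pre_digraph" and C :: "'a set"
  assume GI: "GI_graph k G C"
  show "min_code ID G C"
    using GI_min_code[OF GI GI_is_code_ID[OF GI]] .
  show "(\<nexists>v. isolated (G \<restriction> C) v) \<longleftrightarrow> admissible ITD (G \<restriction> C)"
  proof
    show "admissible ITD (G \<restriction> C)" if "\<nexists>v. isolated (G \<restriction> C) v"
      using GI_induced_ITD_admissible[OF GI that] .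
    show "\<nexists>v. isolated (G \<restriction> C) v" if "admissible ITD (G \<restriction> C)"
      using that isolated_imp_not_ITD_admissible by metis
  qed
  show "min_code ITD G C" if "\<nexists>v. isolated (G \<restriction> C) v"
    using GI_min_code[OF GI GI_is_code_ITD[OF GI that]] .
  fix X
  assume "X = ID \<or> (X = ITD \<and> (\<nexists>v. isolated (G \<restriction> C) v))"
  then have code: "is_code X G C"
    using GI_is_code_ID[OF GI] GI_is_code_ITD[OF GI] by blast
  then show "admissible X G"
    unfolding admissible_def by blast
  show "code_number X G = k"
    using GI_code_number[OF GI code] .
  fix H :: "('c, 'd) pre_digraph"
  assume H: "graph H \<and> admissible X H \<and> code_number X H = k"
  then interpret H: graph H
    by blast
  show "code_density X G \<le> code_density X H"
    by (rule GI_code_density_le[OF GI code H.finite_verts]) (use H in blast)+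
qed (rule GI_graph_exists[OF assms])

end
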